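(* Let $Z$ be any smooth toric variety proper over $\mathbf A^2$, with fan $\Delta$. Let $L_{h_1}$ and $L_{h_2}$ be two linearized line bundles on $Z$ generated by global sections and suppose that $h_1$ and $h_2$ are strictly convex on the same fan. Then the product of sections $$m_{h_1,h_2}:H^0(Z,L_{h_1})\otimes H^0(Z,L_{h_2})\longrightarrow H^0(Z,L_{h_1+h_2})$$ is surjective.
   Context: Work over $\mathbf C$. Let $N=\mathbf Z^l$ (here $l=2$) with basis $e_1,\dots,e_l$ and $M=\mathrm{Hom}(N,\mathbf Z)$ with dual basis $f_1,\dots,f_l$; $\sigma(v_1,\dots,v_r)$ is the cone generated by $v_1,\dots,v_r$. $\mathbf A^l$ is the toric variety whose fan consists of the faces of $\sigma(e_1,\dots,e_l)$. A toric variety proper over $\mathbf A^l$ is a toric variety for the same torus whose fan $\Delta$ in $N_{\mathbf R}$ has support $|\Delta|=\sigma(e_1,\dots,e_l)$ (i.e. it has a proper equivariant morphism to $\mathbf A^l$ which is the identity on the torus). $\Delta(l)$ is the set of maximal cones. A $(\Delta,M)$-linear function is a function $h:|\Delta|\to\mathbf R$ which on each $\sigma\in\Delta(l)$ coincides with an element $h|\sigma\in M$; $L_h$ is the corresponding linearized line bundle (the torus acts on the fibre over the fixed point $x_\sigma$ by the character $-h|\sigma$), and every linearized line bundle is of this form. $h$ is convex if $h(v+v')\ge h(v)+h(v')$ for all $v,v'\in|\Delta|$; it is strictly convex on a fan if moreover it is linear on the cones of that fan and $h|\sigma\ne h|\sigma'$ for distinct maximal cones $\sigma,\sigma'$ of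 that fan. "$h_1$ and $h_2$ are strictly convex on the same fan" means: there is a fan $\Delta'$ with support $|\Delta|$, of which $\Delta$ is a refinement (its toric variety $Z'$ may be singular), such that $h_1$ and $h_2$ are both $(\Delta',M)$-linear and strictly convex on $\Delta'$; equivalently, $L_{h_1}$ and $L_{h_2}$ are pullbacks of ample line bundles on one and the same $Z'$. *)

theory Defs
  imports
    "HOL-Analysis.Analysis"
    "HOL-Library.Poly_Mapping"
    "HOL-Library.Function_Algebras"
begin

section \<open>Lattices, cones and fans\<close>

text \<open>
  \<open>N = \<int>\<^sup>l\<close> and \<open>M = Hom(N, \<int>)\<close> are both \<open>int ^ 'l\<close>: an element of \<open>M\<close> is given by its
  coordinates in the dual basis. \<open>N\<^sub>\<real>\<close> is \<open>real ^ 'l\<close>.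
\<close>

definition lattice_point :: "int ^ 'l \<Rightarrow> real ^ 'l" where
  "lattice_point v = (\<chi> i. real_of_int (v $ i))"

definition pairing :: "int ^ 'l \<Rightarrow> real ^ 'l::finite \<Rightarrow> real" where
  "pairing m v = lattice_point m \<bullet> v"

definition rational_polyhedral_cone :: "(real ^ 'l::finite) set \<Rightarrow> bool" where
  "rational_polyhedral_cone \<sigma> \<longleftrightarrow>
     (\<exists>V :: (int ^ 'l) set. finite V \<and> \<sigma> = convex_cone hull (lattice_point ` V))"

definition strongly_convex_cone :: "'a::real_vector set \<Rightarrow> bool" where
  "strongly_convex_cone \<sigma> \<longleftrightarrow> \<sigma> \<inter> uminus ` \<sigma> = {0}"

text \<open>
  The library relation \<open>face_of\<close> also counts the empty set as a face; for a polyhedral cone its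
  nonempty faces are the sets \<open>\<sigma> \<inter> u\<^sup>\<bottom>\<close> with \<open>u \<ge> 0\<close> on \<open>\<sigma>\<close>.
\<close>

definition cone_face :: "'a::real_vector set \<Rightarrow> 'a set \<Rightarrow> bool" where
  "cone_face \<tau> \<sigma> \<longleftrightarrow> \<tau> face_of \<sigma> \<and> \<tau> \<noteq> {}"

definition fan :: "(real ^ 'l::finite) set set \<Rightarrow> bool" where
  "fan \<Delta> \<longleftrightarrow> finite \<Delta> \<and> \<Delta> \<noteq> {} \<and>
     (\<forall>\<sigma>\<in>\<Delta>. rational_polyhedral_cone \<sigma> \<and> strongly_convex_cone \<sigma>) \<and>
     (\<forall>\<sigma>\<in>\<Delta>. \<forall>\<tau>. cone_face \<tau> \<sigma> \<longrightarrow> \<tau> \<in> \<Delta>) \<and>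
     (\<forall>\<sigma>\<in>\<Delta>. \<forall>\<sigma>'\<in>\<Delta>. cone_face (\<sigma> \<inter> \<sigma>') \<sigma> \<and> cone_face (\<sigma> \<inter> \<sigma>') \<sigma>')"

definition support :: "'a set set \<Rightarrow> 'a set" where
  "support \<Delta> = \<Union> \<Delta>"

definition max_cones :: "'a set set \<Rightarrow> 'a set set" where
  "max_cones \<Delta> = {\<sigma> \<in> \<Delta>. \<forall>\<tau>\<in>\<Delta>. \<sigma> \<subseteq> \<tau> \<longrightarrow> \<tau> = \<sigma>}"

definition refines :: "'a set set \<Rightarrow> 'a set set \<Rightarrow> bool" where
  "refines \<Delta> \<Delta>' \<longleftrightarrow> support \<Delta> = support \<Delta>' \<and> (\<forall>\<sigma>\<in>\<Delta>. \<exists>\<sigma>'\<in>\<Delta>'. \<sigma> \<subseteq> \<sigma>')"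

definition lattice_basis :: "('l \<Rightarrow> int ^ 'l::finite) \<Rightarrow> bool" where
  "lattice_basis b \<longleftrightarrow> (\<forall>v. \<exists>!c :: int ^ 'l. v = (\<Sum>i\<in>UNIV. c $ i *s b i))"

text \<open>
  A toric variety is smooth iff each cone of its fan is generated by part of a basis of \<open>N\<close>.
\<close>

definition smooth_fan :: "(real ^ 'l::finite) set set \<Rightarrow> bool" where
  "smooth_fan \<Delta> \<longleftrightarrow> fan \<Delta> \<and>
     (\<forall>\<sigma>\<in>\<Delta>. \<exists>b S. lattice_basis b \<and> \<sigma> = convex_cone hull (lattice_point ` b ` S))"

text \<open>
  The cone \<open>\<sigma>(e\<^sub>1, \<dots>, e\<^sub>l)\<close>; its faces form the fan of affine space \<open>\<bbbA>\<^sup>l\<close>.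
\<close>

definition affine_space_cone :: "(real ^ 'l::finite) set" where
  "affine_space_cone = convex_cone hull (range (\<lambda>i. lattice_point (axis i 1)))"

definition fan_proper_over_affine_space :: "(real ^ 'l::finite) set set \<Rightarrow> bool" where
  "fan_proper_over_affine_space \<Delta> \<longleftrightarrow> fan \<Delta> \<and> support \<Delta> = affine_space_cone"


section \<open>Linear functions on fans\<close>

text \<open>
  A function on \<open>|\<Delta>|\<close> is a function on all of \<open>N\<^sub>\<real>\<close> whose values off \<open>|\<Delta>|\<close> are never used.
\<close>

definition fan_linear :: "(real ^ 'l::finite) set set \<Rightarrow> (real ^ 'l \<Rightarrow> real) \<Rightarrow> bool" where
  "fan_linear \<Delta> h \<longleftrightarrow> (\<forall>\<sigma>\<in>max_cones \<Delta>. \<exists>m. \<forall>v\<in>\<sigma>. h v = pairing m v)"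

text \<open>
  \<open>h|\<sigma>\<close> as an element of \<open>M\<close>; it is unique because \<open>\<sigma>\<close> is \<open>l\<close>-dimensional whenever \<open>\<sigma>\<close> is a
  maximal cone of a fan with support \<open>\<sigma>(e\<^sub>1, \<dots>, e\<^sub>l)\<close>.
\<close>

definition local_character :: "(real ^ 'l::finite \<Rightarrow> real) \<Rightarrow> (real ^ 'l) set \<Rightarrow> int ^ 'l" where
  "local_character h \<sigma> = (THE m. \<forall>v\<in>\<sigma>. h v = pairing m v)"

definition convex_function :: "'a::real_vector set set \<Rightarrow> ('a \<Rightarrow> real) \<Rightarrow> bool" where
  "convex_function \<Delta> h \<longleftrightarrow>
     (\<forall>v\<in>support \<Delta>. \<forall>v'\<in>support \<Delta>. h (v + v') \<ge> h v + h v')"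

definition strictly_convex :: "(real ^ 'l::finite) set set \<Rightarrow> (real ^ 'l \<Rightarrow> real) \<Rightarrow> bool" where
  "strictly_convex \<Delta> h \<longleftrightarrow> fan_linear \<Delta> h \<and> convex_function \<Delta> h \<and>
     (\<forall>\<sigma>\<in>max_cones \<Delta>. \<forall>\<sigma>'\<in>max_cones \<Delta>.
        \<sigma> \<noteq> \<sigma>' \<longrightarrow> local_character h \<sigma> \<noteq> local_character h \<sigma>')"

definition strictly_convex_on_same_fan ::
    "(real ^ 'l::finite) set set \<Rightarrow> (real ^ 'l \<Rightarrow> real) \<Rightarrow> (real ^ 'l \<Rightarrow> real) \<Rightarrow> bool" where
  "strictly_convex_on_same_fan \<Delta> h\<^sub>1 h\<^sub>2 \<longleftrightarrow>
     (\<exists>\<Delta>'. fan \<Delta>' \<and> refines \<Delta> \<Delta>' \<and> strictly_convex \<Delta>' h\<^sub>1 \<and> strictly_convex \<Delta>' h\<^sub>2)"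


section \<open>Line bundles and their global sections\<close>

text \<open>
  The coordinate ring \<open>\<complex>[M]\<close> of the torus is \<open>int ^ 'l \<Rightarrow>\<^sub>0 complex\<close> with convolution as
  multiplication, the character \<open>\<chi>\<^sup>m\<close> being \<open>Poly_Mapping.single m 1\<close>. The affine chart
  \<open>U\<^sub>\<sigma>\<close> is the spectrum of the subring \<open>\<complex>[\<sigma>\<^sup>\<or> \<inter> M]\<close>.
\<close>

definition chart_ring :: "(real ^ 'l::finite) set \<Rightarrow> (int ^ 'l \<Rightarrow>\<^sub>0 complex) set" where
  "chart_ring \<sigma> = {f. \<forall>m\<in>Poly_Mapping.keys f. \<forall>v\<in>\<sigma>. pairing m v \<ge> 0}"

text \<open>
  The toric variety of \<open>\<Delta>\<close> is glued from the charts \<open>U\<^sub>\<sigma>\<close>, \<open>\<sigma> \<in> \<Delta>(l)\<close>, along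
  \<open>U\<^sub>\<sigma> \<inter> U\<^sub>\<sigma>\<^sub>' = U\<^bsub>\<sigma> \<inter> \<sigma>'\<^esub>\<close>. The line bundle \<open>L\<^sub>h\<close> is trivial on \<open>U\<^sub>\<sigma>\<close> with generator \<open>\<epsilon>\<^sub>\<sigma>\<close>, and
  \<open>\<epsilon>\<^sub>\<sigma>\<^sub>' = \<chi>\<^sup>m \<epsilon>\<^sub>\<sigma>\<close> on the overlap, where \<open>m = h|\<sigma>' - h|\<sigma>\<close>. The generator \<open>\<epsilon>\<^sub>\<sigma>\<close> corresponds to the
  character \<open>h|\<sigma>\<close>, which has weight \<open>-h|\<sigma>\<close> for the action \<open>(t\<cdot>f)(x) = f(t\<^sup>-\<^sup>1x)\<close>; hence the torus
  acts by \<open>-h|\<sigma>\<close> on the fibre at the fixed point of \<open>U\<^sub>\<sigma>\<close>.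

  A global section is a family of local sections \<open>s\<^sub>\<sigma> \<epsilon>\<^sub>\<sigma>\<close> on the charts that agree on the overlaps.
  The agreement can be tested in \<open>\<complex>[M]\<close> because it contains every ring \<open>\<complex>[(\<sigma> \<inter> \<sigma>')\<^sup>\<or> \<inter> M]\<close>.
  Families are indexed by \<open>\<Delta>(l)\<close> and extended by \<open>0\<close>.
\<close>

type_synonym 'l section_family = "(real ^ 'l) set \<Rightarrow> (int ^ 'l \<Rightarrow>\<^sub>0 complex)"

definition global_sections ::
    "(real ^ 'l::finite) set set \<Rightarrow> (real ^ 'l \<Rightarrow> real) \<Rightarrow> 'l section_family set" where
  "global_sections \<Delta> h =
     {s. (\<forall>\<sigma>\<in>max_cones \<Delta>. s \<sigma> \<in> chart_ring \<sigma>) \<and>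
         (\<forall>\<sigma>\<in>max_cones \<Delta>. \<forall>\<sigma>'\<in>max_cones \<Delta>.
            s \<sigma> = Poly_Mapping.single (local_character h \<sigma>' - local_character h \<sigma>) 1 * s \<sigma>') \<and>
         (\<forall>\<sigma>. \<sigma> \<notin> max_cones \<Delta> \<longrightarrow> s \<sigma> = 0)}"

text \<open>
  On each chart, the restrictions of the global sections generate the module
  \<open>\<complex>[\<sigma>\<^sup>\<or> \<inter> M] \<epsilon>\<^sub>\<sigma>\<close> of all sections.
\<close>

definition globally_generated ::
    "(real ^ 'l::finite) set set \<Rightarrow> (real ^ 'l \<Rightarrow> real) \<Rightarrow> bool" where
  "globally_generated \<Delta> h \<longleftrightarrow>
     (\<forall>\<sigma>\<in>max_cones \<Delta>. \<forall>f\<in>chart_ring \<sigma>. \<exists>(n::nat) g s.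
        (\<forall>i<n. g i \<in> chart_ring \<sigma> \<and> s i \<in> global_sections \<Delta> h) \<and>
        f = (\<Sum>i<n. g i * s i \<sigma>))"


section \<open>Tensor products and multiplication of sections\<close>

text \<open>
  The tensor product over \<open>\<complex>\<close> of two subspaces \<open>A\<close>, \<open>B\<close> of a complex vector space with scalar
  multiplication \<open>scl\<close>: the free vector space on \<open>A \<times> B\<close> modulo the bilinearity relations.
\<close>

definition formal_tensors :: "'a set \<Rightarrow> 'a set \<Rightarrow> ('a \<times> 'a \<Rightarrow>\<^sub>0 complex) set" where
  "formal_tensors A B = {x. Poly_Mapping.keys x \<subseteq> A \<times> B}"

definition bilinearity_relations ::
    "(complex \<Rightarrow> 'a \<Rightarrow> 'a::ab_group_add) \<Rightarrow> 'a set \<Rightarrow> 'a set \<Rightarrow> ('a \<times> 'a \<Rightarrow>\<^sub>0 complex) set" where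
  "bilinearity_relations scl A B = module.span (\<lambda>c. Poly_Mapping.map ((*) c))
     ({Poly_Mapping.single (a + a', b) 1 - Poly_Mapping.single (a, b) 1 - Poly_Mapping.single (a', b) 1
        | a a' b. a \<in> A \<and> a' \<in> A \<and> b \<in> B} \<union>
      {Poly_Mapping.single (a, b + b') 1 - Poly_Mapping.single (a, b) 1 - Poly_Mapping.single (a, b') 1
        | a b b'. a \<in> A \<and> b \<in> B \<and> b' \<in> B} \<union>
      {Poly_Mapping.single (scl c a, b) 1 - Poly_Mapping.single (a, b) c
        | c a b. a \<in> A \<and> b \<in> B} \<union>
      {Poly_Mapping.single (a, scl c b) 1 - Poly_Mapping.single (a, b) c
        | c a b. a \<in> A \<and> b \<in> B})"

definition tensor_product ::
    "(complex \<Rightarrow> 'a \<Rightarrow> 'a::ab_group_add) \<Rightarrow> 'a set \<Rightarrow> 'a set \<Rightarrow> ('a \<times> 'a \<Rightarrow>\<^sub>0 complex) set set" where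
  "tensor_product scl A B = formal_tensors A B //
     {(x, y). x \<in> formal_tensors A B \<and> y \<in> formal_tensors A B \<and>
              x - y \<in> bilinearity_relations scl A B}"

definition section_scale :: "complex \<Rightarrow> 'l::finite section_family \<Rightarrow> 'l section_family" where
  "section_scale c s = (\<lambda>\<sigma>. Poly_Mapping.single 0 c * s \<sigma>)"

text \<open>
  The product of \<open>s\<close> and \<open>t\<close> is chartwise, as \<open>\<epsilon>\<^sub>\<sigma> \<otimes> \<epsilon>\<^sub>\<sigma>\<close> is the generator of
  \<open>L\<^bsub>h\<^sub>1 + h\<^sub>2\<^esub> = L\<^bsub>h\<^sub>1\<^esub> \<otimes> L\<^bsub>h\<^sub>2\<^esub>\<close> on \<open>U\<^sub>\<sigma>\<close>.
\<close>

definition formal_multiplication ::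
    "('l section_family \<times> 'l section_family \<Rightarrow>\<^sub>0 complex) \<Rightarrow> 'l::finite section_family" where
  "formal_multiplication x =
     (\<Sum>(s, t)\<in>Poly_Mapping.keys x. section_scale (Poly_Mapping.lookup x (s, t)) (s * t))"

text \<open>
  The induced map on classes of formal tensors; \<open>formal_multiplication\<close> is constant on each class
  by \<open>multiplication_map_class\<close> below.
\<close>

definition multiplication_map ::
    "('l section_family \<times> 'l section_family \<Rightarrow>\<^sub>0 complex) set \<Rightarrow> 'l::finite section_family" where
  "multiplication_map X = the_elem (formal_multiplication ` X)"

lemma lookup_poly_mapping_scale:
  "Poly_Mapping.lookup (Poly_Mapping.map ((*) c) x) k = (c::complex) * Poly_Mapping.lookup x k"
  by (simp add: Poly_Mapping.map.rep_eq when_def)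

lemma module_poly_mapping_scale: "module (\<lambda>c::complex. Poly_Mapping.map ((*) c))"
  by unfold_locales
     (auto intro!: poly_mapping_eqI
        simp: Poly_Mapping.lookup_add lookup_poly_mapping_scale algebra_simps)

lemma section_scale_sum:
  "section_scale c (\<Sum>p\<in>S. f p) = (\<Sum>p\<in>S. section_scale c (f p))"
  by (induction S rule: infinite_finite_induct)
     (auto simp: section_scale_def fun_eq_iff distrib_left)

lemma formal_multiplication_superset:
  assumes "finite S" "Poly_Mapping.keys x \<subseteq> S"
  shows "formal_multiplication x =
     (\<Sum>(s, t)\<in>S. section_scale (Poly_Mapping.lookup x (s, t)) (s * t))"
  unfolding formal_multiplication_def using assms
  by (intro sum.mono_neutral_left)
     (auto simp: section_scale_def in_keys_iff zero_fun_def)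

lemma formal_multiplication_add:
  "formal_multiplication (x + y) = formal_multiplication x + formal_multiplication y"
proof -
  let ?S = "Poly_Mapping.keys x \<union> Poly_Mapping.keys y"
  have "Poly_Mapping.keys (x + y) \<subseteq> ?S"
    by (rule Poly_Mapping.keys_add)
  then show ?thesis
    by (simp add: formal_multiplication_superset[of ?S] flip: sum.distrib)
       (auto intro!: sum.cong
          simp: section_scale_def plus_fun_def Poly_Mapping.lookup_add single_add distrib_right)
qed

lemma formal_multiplication_scale:
  "formal_multiplication (Poly_Mapping.map ((*) c) x) = section_scale c (formal_multiplication x)"
proof -
  let ?S = "Poly_Mapping.keys x"
  have "Poly_Mapping.keys (Poly_Mapping.map ((*) c) x) \<subseteq> ?S"
    by (auto simp: in_keys_iff lookup_poly_mapping_scale)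
  then have "formal_multiplication (Poly_Mapping.map ((*) c) x) =
      (\<Sum>(s, t)\<in>?S. section_scale (c * Poly_Mapping.lookup x (s, t)) (s * t))"
    by (simp add: formal_multiplication_superset[of ?S] lookup_poly_mapping_scale)
  also have "\<dots> = section_scale c (formal_multiplication x)"
    unfolding formal_multiplication_def section_scale_sum
    by (rule sum.cong)
       (auto simp: section_scale_def fun_eq_iff mult_single simp flip: mult.assoc)
  finally show ?thesis .
qed

lemma formal_multiplication_diff:
  "formal_multiplication (x - y) = formal_multiplication x - formal_multiplication y"
  using formal_multiplication_add[of "x - y" y] by simp

lemma formal_multiplication_single:
  "formal_multiplication (Poly_Mapping.single (s, t) c) = section_scale c (s * t)"
  by (subst formal_multiplication_superset[of "{(s, t)}"]) auto

lemma formal_multiplication_bilinearity_relations: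
  assumes "x \<in> bilinearity_relations section_scale A B"
  shows "formal_multiplication x = 0"
proof -
  interpret P: module "\<lambda>c::complex. Poly_Mapping.map ((*) c)"
    by (rule module_poly_mapping_scale)
  show ?thesis
    using assms unfolding bilinearity_relations_def
  proof (induction rule: P.span_induct_alt)
    case base
    show ?case
      by (simp add: formal_multiplication_def)
  next
    case (step c x y)
    have "formal_multiplication x = 0"
      using step.hyps
      by (elim UnE CollectE exE conjE)
         (simp_all add: formal_multiplication_diff formal_multiplication_single
            distrib_left distrib_right section_scale_def fun_eq_iff ac_simps)
    then show ?case
      using step.IH
      by (simp add: formal_multiplication_add formal_multiplication_scale section_scale_def
          zero_fun_def)
  qed
qed

lemma multiplication_map_class:
  assumes "X \<in> tensor_product section_scale A B" "x \<in> X"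
  shows "multiplication_map X = formal_multiplication x"
proof -
  interpret P: module "\<lambda>c::complex. Poly_Mapping.map ((*) c)"
    by (rule module_poly_mapping_scale)
  obtain z where z: "X = {y \<in> formal_tensors A B. z - y \<in> bilinearity_relations section_scale A B}"
    using assms(1) by (auto simp: tensor_product_def quotient_def)
  have "formal_multiplication y = formal_multiplication z" if "y \<in> X" for y
    using that formal_multiplication_bilinearity_relations[of "z - y" A B] z
    by (simp add: formal_multiplication_diff)
  then have "formal_multiplication ` X = {formal_multiplication x}"
    using assms(2) by auto
  then show ?thesis
    by (simp add: multiplication_map_def)
qed

end

(*
  Sections of L_h are combinations of the characters m with m >= h on the quadrant, so it suffices to
  write every such lattice point m for h1 + h2 as a sum of lattice points for h1 and h2. Let a and b
  assign to a maximal cone of the common fan the restrictions of h1 and h2. If m is not in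
  a s + b s + N^2 for any maximal cone s, connectedness of the segment from e1 to e2 gives maximal
  cones s and t with a common vector v such that the x-coordinate of m lies between those of
  a s + b s and a t + b t. If that x-coordinate is at most that of a t + b s, then m - b s lies
  between a s and a t, on or above the edge joining them, so m = (m - b s) + b s is a decomposition;
  otherwise m = a t + (m - a t) is one.
*)
theory Submission
  imports Defs
begin

section \<open>Fans over affine space\<close>

lemma pairing_add_left: "pairing (m + n) v = pairing m v + pairing n v"
  by (simp add: pairing_def lattice_point_def inner_vec_def algebra_simps sum.distrib)

lemma pairing_diff_left: "pairing (m - n) v = pairing m v - pairing n v"
  by (simp add: pairing_def lattice_point_def inner_vec_def algebra_simps sum_subtractf)

lemma pairing_add_right: "pairing m (v + w) = pairing m v + pairing m w"
  by (simp add: pairing_def inner_add_right)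

lemma pairing_scaleR_right: "pairing m (c *\<^sub>R v) = c * pairing m v"
  by (simp add: pairing_def)

text \<open>The orthant is a convex cone containing the generators, and each of its points combines
  them with its own coordinates as coefficients.\<close>

lemma affine_space_cone_eq:
  "affine_space_cone = {v :: real ^ 'l::finite. \<forall>i. v $ i \<ge> 0}"
proof
  let ?Q = "{v :: real ^ 'l. \<forall>i. v $ i \<ge> 0}"
  have "convex_cone ?Q"
    by (simp add: convex_cone_iff)
  then show "affine_space_cone \<subseteq> ?Q"
    unfolding affine_space_cone_def
    by (intro hull_minimal) (auto simp: lattice_point_def axis_def)
  show "?Q \<subseteq> affine_space_cone"
  proof
    fix v assume v: "v \<in> ?Q"
    have gen: "lattice_point (axis i 1) \<in> (affine_space_cone :: (real ^ 'l) set)" for i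
      unfolding affine_space_cone_def by (intro hull_inc) auto
    have cone: "convex_cone (affine_space_cone :: (real ^ 'l) set)"
      unfolding affine_space_cone_def by (rule convex_cone_convex_cone_hull)
    have "(\<Sum>i\<in>I. v $ i *\<^sub>R lattice_point (axis i 1)) \<in> affine_space_cone" if "finite I" for I
      using that
      by (induction I)
        (use v gen cone in \<open>auto intro!: convex_cone_add convex_cone_scaleR convex_cone_contains_0\<close>)
    moreover have "(\<Sum>i\<in>UNIV. v $ i *\<^sub>R lattice_point (axis i 1)) = v"
      by (simp add: vec_eq_iff lattice_point_def axis_def if_distrib cong: if_cong)
    ultimately show "v \<in> affine_space_cone"
      by (metis finite)
  qed
qed

section \<open>Topology of the cones and full-dimensionality of the maximal ones\<close>

lemma closed_cone_of_fan: "fan \<Delta> \<Longrightarrow> \<sigma> \<in> \<Delta> \<Longrightarrow> closed \<sigma>"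
  by (auto simp: fan_def rational_polyhedral_cone_def intro!: closed_convex_cone_hull)

lemma convex_cone_of_fan: "fan \<Delta> \<Longrightarrow> \<sigma> \<in> \<Delta> \<Longrightarrow> convex_cone \<sigma>"
  by (auto simp: fan_def rational_polyhedral_cone_def convex_cone_convex_cone_hull)

text \<open>Carries information from a full-dimensional cone over to arbitrary directions
  \<open>v\<close>.\<close>

lemma interior_direction:
  fixes w v :: "'a::real_normed_vector"
  assumes "w \<in> interior S"
  obtains e where "e > 0" "w + e *\<^sub>R v \<in> S"
proof -
  obtain d where d: "d > 0" "ball w d \<subseteq> S"
    using assms by (auto simp: mem_interior)
  \<comment> \<open>Adding 1 keeps the denominator positive when \<open>v = 0\<close>.\<close>
  define e where "e = d / (2 * (norm v + 1))"
  have "e > 0"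
    using d by (simp add: e_def add_nonneg_pos)
  moreover have "e * norm v < d"
  proof -
    have "norm v * d < 2 * (norm v + 1) * d"
      using d by (intro mult_strict_right_mono) (auto intro: add_nonneg_pos)
    then show ?thesis
      unfolding e_def by (simp add: divide_less_eq add_nonneg_pos mult.commute)
  qed
  then have "w + e *\<^sub>R v \<in> S"
    using d \<open>e > 0\<close> by (intro subsetD[OF d(2)]) (simp add: dist_norm)
  ultimately show thesis
    by (rule that)
qed

lemma max_cone_above:
  assumes "finite \<Delta>" "\<sigma> \<in> \<Delta>"
  obtains \<tau> where "\<tau> \<in> max_cones \<Delta>" "\<sigma> \<subseteq> \<tau>"
  using finite_has_maximal2[OF assms] by (auto simp: max_cones_def)

text \<open>By finiteness each cone lies in a maximal one. Since \<open>fan_linear\<close> speaks of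
  maximal cones only, points of the support have to be placed in such a cone.\<close>

lemma support_eq_max_cones: "finite \<Delta> \<Longrightarrow> support \<Delta> = \<Union> (max_cones \<Delta>)"
  unfolding support_def by (auto simp: max_cones_def) (metis finite_has_maximal2 subsetD)

text \<open>
  The cones with empty interior are negligible, so the others are dense in the support, hence cover
  it; a relative interior point of \<open>\<sigma>\<close> then lies in a cone \<open>\<tau>\<close> of the latter kind, and \<open>\<sigma> \<inter> \<tau>\<close>
  is a face of \<open>\<sigma>\<close> through that point.
\<close>

lemma interior_max_cone_nonempty:
  fixes \<Delta> :: "(real ^ 'l::finite) set set"
  assumes "fan_proper_over_affine_space \<Delta>" and max: "\<sigma> \<in> max_cones \<Delta>"
  shows "interior \<sigma> \<noteq> {}"
proof -
  let ?Q = "affine_space_cone :: (real ^ 'l) set"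
  have fan: "fan \<Delta>" and supp: "\<Union> \<Delta> = ?Q"
    using assms by (auto simp: fan_proper_over_affine_space_def support_def)
  have fin: "finite \<Delta>" and \<sigma>: "\<sigma> \<in> \<Delta>"
    using fan max by (auto simp: fan_def max_cones_def)
  have convex: "convex \<tau>" if "\<tau> \<in> \<Delta>" for \<tau>
    using convex_cone_of_fan[OF fan that] by (simp add: convex_cone_def)
  define F where "F = {\<tau>\<in>\<Delta>. interior \<tau> \<noteq> {}}"
  have negl: "negligible (\<Union> (\<Delta> - F))"
    using fin by (intro negligible_Union) (auto simp: F_def negligible_convex_interior convex)
  have closed: "closed (\<Union> F)"
    using fin by (intro closed_Union) (auto simp: F_def closed_cone_of_fan[OF fan])
  have "interior ?Q \<subseteq> \<Union> F"
  proof (rule ccontr)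
    assume "\<not> interior ?Q \<subseteq> \<Union> F"
    then have "interior ?Q - \<Union> F \<noteq> {}" by auto
    moreover have "open (interior ?Q - \<Union> F)"
      using closed by auto
    ultimately have "\<not> negligible (interior ?Q - \<Union> F)"
      using open_not_negligible by blast
    moreover have "interior ?Q - \<Union> F \<subseteq> \<Union> (\<Delta> - F)"
      using interior_subset[of ?Q] unfolding supp[symmetric] by blast
    ultimately show False
      using negl negligible_subset by blast
  qed
  moreover have "closure (interior ?Q) = ?Q"
  proof -
    have "convex ?Q"
      by (simp add: affine_space_cone_def convex_convex_cone_hull)
    moreover have "open (\<Inter>i\<in>UNIV. {v :: real ^ 'l. v $ i > 0})"
      by (intro open_INT ballI open_halfspace_component_gt_cart) auto
    then have "open {v :: real ^ 'l. \<forall>i. v $ i > 0}"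
      by (rule back_subst[where P = "open"]) auto
    then have "{v :: real ^ 'l. \<forall>i. v $ i > 0} \<subseteq> interior ?Q"
      by (intro interior_maximal) (auto simp: affine_space_cone_eq less_imp_le)
    \<comment> \<open>The witness \<open>1\<close> is the vector with all coordinates equal to
      1.\<close>
    then have "interior ?Q \<noteq> {}"
      using someI[of "\<lambda>v :: real ^ 'l. \<forall>i. v $ i > 0" 1] by auto
    moreover have "closed ?Q"
      unfolding affine_space_cone_def by (intro closed_convex_cone_hull) auto
    ultimately show ?thesis
      using convex_closure_interior[of ?Q] by simp
  qed
  ultimately have cover: "?Q \<subseteq> \<Union> F"
    using closure_minimal[of "interior ?Q" "\<Union> F"] closed by simp
  have "\<sigma> \<noteq> {}"
    using convex_cone_of_fan[OF fan \<sigma>] by (rule convex_cone_nonempty)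
  then obtain w where w: "w \<in> rel_interior \<sigma>"
    using rel_interior_eq_empty convex \<sigma> by blast
  then have "w \<in> \<sigma>"
    using rel_interior_subset by blast
  then have "w \<in> ?Q"
    unfolding supp[symmetric] using \<sigma> by (rule UnionI[rotated])
  then obtain \<tau> where \<tau>: "\<tau> \<in> \<Delta>" "interior \<tau> \<noteq> {}" "w \<in> \<tau>"
    using subsetD[OF cover] unfolding F_def by blast
  have "\<forall>\<sigma>\<in>\<Delta>. \<forall>\<sigma>'\<in>\<Delta>. cone_face (\<sigma> \<inter> \<sigma>') \<sigma>"
    using fan by (simp add: fan_def)
  then have "(\<sigma> \<inter> \<tau>) face_of \<sigma>"
    using \<sigma> \<tau>(1) by (simp add: cone_face_def)
  \<comment> \<open>A face of \<sigma> that meets the relative interior of \<sigma> is all of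
    \<sigma>; maximality then identifies \<sigma> with \<tau>.\<close>
  then have "\<sigma> \<subseteq> \<sigma> \<inter> \<tau>"
    by (rule subset_of_face_of) (use w \<tau>(3) \<open>w \<in> \<sigma>\<close> in auto)
  then have "\<tau> = \<sigma>"
    using max \<tau>(1) by (simp add: max_cones_def)
  then show ?thesis
    using \<tau>(2) by simp
qed

section \<open>Uniqueness and additivity of local characters\<close>

lemma pairing_eq_on_interior:
  assumes "interior \<sigma> \<noteq> {}" and eq: "\<And>v. v \<in> \<sigma> \<Longrightarrow> pairing m v = pairing n v"
  shows "m = n"
proof -
  \<comment> \<open>The difference itself serves as test direction: \<open>d\<close> is orthogonal
    to \<open>w\<close> and to \<open>w + e *\<^sub>R d\<close>, hence to itself.\<close>
  define d where "d = lattice_point (m - n)"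
  obtain w where w: "w \<in> interior \<sigma>"
    using assms by auto
  then obtain e where e: "e > 0" "w + e *\<^sub>R d \<in> \<sigma>"
    by (rule interior_direction)
  have "d \<bullet> v = 0" if "v \<in> \<sigma>" for v
    using eq[OF that] pairing_diff_left[of m n v] by (simp add: pairing_def d_def)
  then have "d \<bullet> w = 0" "d \<bullet> (w + e *\<^sub>R d) = 0"
    using w e interior_subset by auto
  then have "d = 0"
    using e by (simp add: inner_add_right)
  then show ?thesis
    by (simp add: d_def lattice_point_def vec_eq_iff)
qed

text \<open>On a full-dimensional cone the description in \<open>local_character\<close> is unique,
  so exhibiting one character determines its value.\<close>

lemma local_character_eqI:
  assumes "interior \<sigma> \<noteq> {}" "\<And>v. v \<in> \<sigma> \<Longrightarrow> h v = pairing m v"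
  shows "local_character h \<sigma> = m"
  unfolding local_character_def
  by (rule the_equality) (use assms in \<open>auto intro!: pairing_eq_on_interior[OF assms(1)]\<close>)

lemma pairing_local_character:
  assumes "fan_proper_over_affine_space \<Delta>" "fan_linear \<Delta> h" "\<sigma> \<in> max_cones \<Delta>" "v \<in> \<sigma>"
  shows "pairing (local_character h \<sigma>) v = h v"
proof -
  obtain m where m: "\<And>v. v \<in> \<sigma> \<Longrightarrow> h v = pairing m v"
    using assms by (auto simp: fan_linear_def)
  then show ?thesis
    using local_character_eqI[OF interior_max_cone_nonempty[OF assms(1,3)]] assms(4) by metis
qed

lemma fan_linear_add:
  assumes "fan_linear \<Delta> h\<^sub>1" "fan_linear \<Delta> h\<^sub>2"
  shows "fan_linear \<Delta> (h\<^sub>1 + h\<^sub>2)"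
  unfolding fan_linear_def
proof
  fix \<sigma> assume "\<sigma> \<in> max_cones \<Delta>"
  with assms obtain m n where "\<forall>v\<in>\<sigma>. h\<^sub>1 v = pairing m v" "\<forall>v\<in>\<sigma>. h\<^sub>2 v = pairing n v"
    unfolding fan_linear_def by blast
  then show "\<exists>m. \<forall>v\<in>\<sigma>. (h\<^sub>1 + h\<^sub>2) v = pairing m v"
    by (intro exI[of _ "m + n"]) (simp add: pairing_add_left)
qed

lemma local_character_add:
  assumes "fan_proper_over_affine_space \<Delta>" "fan_linear \<Delta> h\<^sub>1" "fan_linear \<Delta> h\<^sub>2" "\<sigma> \<in> max_cones \<Delta>"
  shows "local_character (h\<^sub>1 + h\<^sub>2) \<sigma> = local_character h\<^sub>1 \<sigma> + local_character h\<^sub>2 \<sigma>"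
  using assms
  by (intro local_character_eqI interior_max_cone_nonempty)
    (auto simp: pairing_add_left pairing_local_character)


section \<open>Lattice points of section polyhedra\<close>

text \<open>For a fan-linear \<open>h\<close> these are the exponents of the characters that are
  global sections of the line bundle of \<open>h\<close>. Only the support of the fan enters, so a
  fan may be exchanged for a coarser one.\<close>

definition section_polyhedron ::
    "(real ^ 'l::finite) set set \<Rightarrow> (real ^ 'l \<Rightarrow> real) \<Rightarrow> (int ^ 'l) set" where
  "section_polyhedron \<Delta> h = {m. \<forall>v\<in>support \<Delta>. h v \<le> pairing m v}"

text \<open>From an interior point of \<sigma> a short move along \<open>v\<close> stays in
  \<sigma>, where \<open>h\<close> grows by the local character; superadditivity says that it grows
  at least by the value of \<open>h\<close> on the move.\<close>

lemma local_character_in_section_polyhedron: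
  assumes proper: "fan_proper_over_affine_space \<Delta>" and lin: "fan_linear \<Delta> h"
    and convex: "convex_function \<Delta> h" and \<sigma>: "\<sigma> \<in> max_cones \<Delta>"
  shows "local_character h \<sigma> \<in> section_polyhedron \<Delta> h"
  unfolding section_polyhedron_def
proof (intro CollectI ballI)
  fix v assume v: "v \<in> support \<Delta>"
  have fan: "fan \<Delta>" and fin: "finite \<Delta>"
    using proper by (auto simp: fan_proper_over_affine_space_def fan_def)
  obtain w where w: "w \<in> interior \<sigma>"
    using interior_max_cone_nonempty[OF proper \<sigma>] by auto
  then obtain e where e: "e > 0" "w + e *\<^sub>R v \<in> \<sigma>"
    by (rule interior_direction)
  obtain \<tau> where \<tau>: "\<tau> \<in> max_cones \<Delta>" "v \<in> \<tau>"
    using v support_eq_max_cones[OF fin] by auto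
  then have ev: "e *\<^sub>R v \<in> \<tau>"
    using convex_cone_of_fan[OF fan] e by (auto simp: max_cones_def intro!: convex_cone_scaleR)
  have w': "w \<in> \<sigma>"
    using w interior_subset by auto
  have in_supp: "w \<in> support \<Delta>" "e *\<^sub>R v \<in> support \<Delta>"
    using support_eq_max_cones[OF fin] w' ev \<sigma> \<tau> by auto
  note [simp] = pairing_local_character[OF proper lin]
  \<comment> \<open>Homogeneity of \<open>h\<close> along the ray of \<open>v\<close> comes from
    linearity on the cone \<tau>, which contains both vectors.\<close>
  have "h (e *\<^sub>R v) = e * h v"
    using \<tau> ev pairing_scaleR_right[of "local_character h \<tau>" e v] by simp
  moreover have "h (w + e *\<^sub>R v) = h w + e * pairing (local_character h \<sigma>) v"
    using \<sigma> e w' pairing_add_right[of "local_character h \<sigma>" w "e *\<^sub>R v"]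
    by (simp add: pairing_scaleR_right)
  moreover have "h w + h (e *\<^sub>R v) \<le> h (w + e *\<^sub>R v)"
    using convex in_supp by (auto simp: convex_function_def)
  ultimately show "h v \<le> pairing (local_character h \<sigma>) v"
    using e by simp
qed

section \<open>Plane geometry and decomposition of lattice points\<close>

lemma pairing_2:
  fixes m :: "int ^ 2"
  shows "pairing m v = of_int (m $ 1) * v $ 1 + of_int (m $ 2) * v $ 2"
  by (simp add: pairing_def lattice_point_def inner_vec_def sum_2)

text \<open>The point \<open>p\<close> lies horizontally between \<open>a\<close> and
  \<open>b\<close> and is at least as high as both in direction \<open>v\<close>. The side of
  \<open>v\<close> on which \<open>w\<close> lies decides which of the two bounds \<open>p\<close>
  from below at \<open>w\<close>.\<close>

lemma min_le_pairing_between: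
  fixes p a b :: "int ^ 2"
  assumes x: "a $ 1 \<le> p $ 1" "p $ 1 \<le> b $ 1"
    and v: "v $ 2 > 0" "pairing a v \<le> pairing p v" "pairing b v \<le> pairing p v"
    and w: "w $ 2 \<ge> 0"
  shows "min (pairing a w) (pairing b w) \<le> pairing p w"
proof -
  \<comment> \<open>\<open>D\<close> is the determinant of \<open>w\<close> and \<open>v\<close>.
    The identity below splits the pairing with \<open>w\<close> into the pairing with
    \<open>v\<close> and a horizontal displacement weighted by \<open>D\<close>; for
    \<open>D \<ge> 0\<close> it is applied to \<open>a\<close>, otherwise to
    \<open>b\<close>.\<close>
  define D where "D = w $ 1 * v $ 2 - w $ 2 * v $ 1"
  have id: "v $ 2 * pairing (p - q) w = w $ 2 * pairing (p - q) v + of_int ((p - q) $ 1) * D" for q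
    by (simp add: pairing_2 D_def algebra_simps)
  show ?thesis
  proof (cases "D \<ge> 0")
    case True
    have "0 \<le> w $ 2 * pairing (p - a) v + of_int ((p - a) $ 1) * D"
      using x v w True by (intro add_nonneg_nonneg mult_nonneg_nonneg) (auto simp: pairing_diff_left)
    then have "0 \<le> pairing (p - a) w"
      using v(1) unfolding id[symmetric] zero_le_mult_iff by linarith
    then show ?thesis
      by (simp add: pairing_diff_left)
  next
    case False
    have "0 \<le> w $ 2 * pairing (p - b) v + of_int ((p - b) $ 1) * D"
      using x v w False
      by (intro add_nonneg_nonneg mult_nonneg_nonneg mult_nonpos_nonpos) (auto simp: pairing_diff_left)
    then have "0 \<le> pairing (p - b) w"
      using v(1) unfolding id[symmetric] zero_le_mult_iff by linarith
    then show ?thesis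
      by (simp add: pairing_diff_left)
  qed
qed

lemma section_polyhedron_decompose:
  fixes \<Delta> :: "(real ^ 2) set set"
  assumes proper: "fan_proper_over_affine_space \<Delta>"
    and lin: "fan_linear \<Delta> h\<^sub>1" "fan_linear \<Delta> h\<^sub>2"
    and convex: "convex_function \<Delta> h\<^sub>1" "convex_function \<Delta> h\<^sub>2"
    and m: "m \<in> section_polyhedron \<Delta> (h\<^sub>1 + h\<^sub>2)"
  obtains m\<^sub>1 m\<^sub>2 where "m\<^sub>1 \<in> section_polyhedron \<Delta> h\<^sub>1" "m\<^sub>2 \<in> section_polyhedron \<Delta> h\<^sub>2" "m = m\<^sub>1 + m\<^sub>2"
proof -
  note decomposed = that
  let ?P\<^sub>1 = "section_polyhedron \<Delta> h\<^sub>1" and ?P\<^sub>2 = "section_polyhedron \<Delta> h\<^sub>2"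
  let ?a = "local_character h\<^sub>1" and ?b = "local_character h\<^sub>2"
  have fan: "fan \<Delta>" and fin: "finite \<Delta>" and supp: "support \<Delta> = affine_space_cone"
    using proper by (auto simp: fan_proper_over_affine_space_def fan_def)
  have mem_supp: "v \<in> support \<Delta> \<longleftrightarrow> 0 \<le> v $ 1 \<and> 0 \<le> v $ 2" for v
    by (simp add: supp affine_space_cone_eq forall_2)
  have in_supp: "v \<in> support \<Delta>" if "\<sigma> \<in> max_cones \<Delta>" "v \<in> \<sigma>" for \<sigma> v
    using that support_eq_max_cones[OF fin] by auto
  note a = local_character_in_section_polyhedron[OF proper lin(1) convex(1)]
  note b = local_character_in_section_polyhedron[OF proper lin(2) convex(2)]
  note a_eq = pairing_local_character[OF proper lin(1)]
  note b_eq = pairing_local_character[OF proper lin(2)]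
  have above: "pairing (?a \<sigma>) v + pairing (?b \<sigma>) v \<le> pairing m v"
    if "\<sigma> \<in> max_cones \<Delta>" "v \<in> \<sigma>" for \<sigma> v
    using m in_supp[OF that] by (simp add: section_polyhedron_def a_eq b_eq that)
  \<comment> \<open>Here \<open>m\<close> exceeds the sum of the two local characters by a vector
    with nonnegative entries, and the first summand absorbs this excess.\<close>
  have corner: thesis
    if \<sigma>: "\<sigma> \<in> max_cones \<Delta>" and le: "(?a \<sigma> + ?b \<sigma>) $ 1 \<le> m $ 1" "(?a \<sigma> + ?b \<sigma>) $ 2 \<le> m $ 2" for \<sigma>
  proof (rule decomposed[of "m - ?b \<sigma>" "?b \<sigma>"])
    have "0 \<le> pairing (m - (?a \<sigma> + ?b \<sigma>)) v" if "v \<in> support \<Delta>" for v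
      using le that unfolding pairing_2
      by (intro add_nonneg_nonneg mult_nonneg_nonneg) (auto simp: mem_supp)
    then show "m - ?b \<sigma> \<in> ?P\<^sub>1"
      using a[OF \<sigma>] by (force simp: section_polyhedron_def pairing_diff_left pairing_add_left)
  qed (use b[OF \<sigma>] in auto)
  \<comment> \<open>Both \<open>c\<close> and \<open>d\<close> dominate \<open>h\<close> on the
    quadrant, hence so does the minimum of their pairings, and \<open>p\<close> dominates that
    minimum.\<close>
  have between: "p \<in> section_polyhedron \<Delta> h"
    if "c \<in> section_polyhedron \<Delta> h" "d \<in> section_polyhedron \<Delta> h" "c $ 1 \<le> p $ 1" "p $ 1 \<le> d $ 1"
      "v $ 2 > 0" "pairing c v \<le> pairing p v" "pairing d v \<le> pairing p v" for p c d v h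
    using min_le_pairing_between[OF that(3-7)] that(1,2)
    by (fastforce simp: section_polyhedron_def mem_supp min_le_iff_disj)
  define e\<^sub>1 e\<^sub>2 :: "real ^ 2" where "e\<^sub>1 = axis 1 1" and "e\<^sub>2 = axis 2 1"
  have e_simps [simp]: "e\<^sub>1 $ 1 = 1" "e\<^sub>1 $ 2 = 0" "e\<^sub>2 $ 1 = 0" "e\<^sub>2 $ 2 = 1"
    by (simp_all add: e\<^sub>1_def e\<^sub>2_def axis_def)
  define S where "S = closed_segment e\<^sub>1 e\<^sub>2"
  \<comment> \<open>The cones are sorted by the side of \<open>m\<close> on which the sum of their
    local characters lies horizontally. Every cone enters \<open>A\<close> or \<open>B\<close>, and
    both sets are closed as finite unions of closed cones.\<close>
  define A where "A = \<Union> {\<sigma> \<in> max_cones \<Delta>. (?a \<sigma> + ?b \<sigma>) $ 1 \<le> m $ 1}"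
  define B where "B = \<Union> {\<sigma> \<in> max_cones \<Delta>. m $ 1 \<le> (?a \<sigma> + ?b \<sigma>) $ 1}"
  have closed: "closed A" "closed B"
    unfolding A_def B_def using fin
    by (intro closed_Union; auto intro: closed_cone_of_fan[OF fan] simp: max_cones_def)+
  have S_le: "S \<subseteq> support \<Delta>"
    by (auto simp: S_def closed_segment_def mem_supp)
  then have cover: "S \<subseteq> A \<union> B"
    unfolding support_eq_max_cones[OF fin] A_def B_def by fastforce
  have "e\<^sub>1 \<in> support \<Delta>" "e\<^sub>2 \<in> support \<Delta>"
    by (auto simp: mem_supp)
  then obtain \<sigma>\<^sub>1 \<sigma>\<^sub>2
    where \<sigma>\<^sub>1: "\<sigma>\<^sub>1 \<in> max_cones \<Delta>" "e\<^sub>1 \<in> \<sigma>\<^sub>1" and \<sigma>\<^sub>2: "\<sigma>\<^sub>2 \<in> max_cones \<Delta>" "e\<^sub>2 \<in> \<sigma>\<^sub>2"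
    unfolding support_eq_max_cones[OF fin] by auto
  \<comment> \<open>Evaluation at the two basis vectors reads off single coordinates: the first at
    \<open>e\<^sub>1\<close>, the second at \<open>e\<^sub>2\<close>.\<close>
  have "(?a \<sigma>\<^sub>1 + ?b \<sigma>\<^sub>1) $ 1 \<le> m $ 1"
    using above[OF \<sigma>\<^sub>1] by (simp add: pairing_2)
  then have "e\<^sub>1 \<in> A"
    using \<sigma>\<^sub>1 by (auto simp: A_def)
  have \<sigma>\<^sub>2_le: "(?a \<sigma>\<^sub>2 + ?b \<sigma>\<^sub>2) $ 2 \<le> m $ 2"
    using above[OF \<sigma>\<^sub>2] by (simp add: pairing_2)
  show thesis
  proof (cases "(?a \<sigma>\<^sub>2 + ?b \<sigma>\<^sub>2) $ 1 \<le> m $ 1")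
    case True
    then show ?thesis
      using corner[OF \<sigma>\<^sub>2(1)] \<sigma>\<^sub>2_le by auto
  next
    case False
    then have "e\<^sub>2 \<in> B"
      using \<sigma>\<^sub>2 by (auto simp: B_def)
    have "A \<inter> B \<inter> S \<noteq> {}"
    proof
      assume "A \<inter> B \<inter> S = {}"
      then have "A \<inter> S = {} \<or> B \<inter> S = {}"
        by (intro connected_closedD[of S A B] closed cover) (auto simp: S_def)
      then show False
        using \<open>e\<^sub>1 \<in> A\<close> \<open>e\<^sub>2 \<in> B\<close> by (auto simp: S_def)
    qed
    then obtain v \<sigma> \<tau> where v: "v \<in> S" "v \<in> \<sigma>" "v \<in> \<tau>"
      and \<sigma>: "\<sigma> \<in> max_cones \<Delta>" "(?a \<sigma> + ?b \<sigma>) $ 1 \<le> m $ 1"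
      and \<tau>: "\<tau> \<in> max_cones \<Delta>" "m $ 1 \<le> (?a \<tau> + ?b \<tau>) $ 1"
      by (auto simp: A_def B_def)
    \<comment> \<open>Both cones contain \<open>v\<close>, so their local characters have the same
      value there. Thus \<open>v\<close> is normal to the edges from \<open>?a \<sigma>\<close> to
      \<open>?a \<tau>\<close> and from \<open>?b \<sigma>\<close> to \<open>?b \<tau>\<close>, and
      \<open>above\<close> at \<open>v\<close> bounds \<open>m\<close> against both ends.\<close>
    have eqs: "pairing (?a \<sigma>) v = pairing (?a \<tau>) v" "pairing (?b \<sigma>) v = pairing (?b \<tau>) v"
      using v \<sigma> \<tau> by (simp_all add: a_eq b_eq)
    show ?thesis
    proof (cases "v $ 2 > 0")
      case v2: True
      show ?thesis
      proof (cases "m $ 1 \<le> (?a \<tau> + ?b \<sigma>) $ 1")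
        case True
        have "m - ?b \<sigma> \<in> ?P\<^sub>1"
          by (rule between[OF a[OF \<sigma>(1)] a[OF \<tau>(1)] _ _ v2])
            (use True \<sigma> above[OF \<sigma>(1) v(2)] eqs in \<open>auto simp: pairing_diff_left\<close>)
        then show ?thesis
          using b[OF \<sigma>(1)] by (intro decomposed[of "m - ?b \<sigma>" "?b \<sigma>"]) auto
      next
        case False
        have "m - ?a \<tau> \<in> ?P\<^sub>2"
          by (rule between[OF b[OF \<sigma>(1)] b[OF \<tau>(1)] _ _ v2])
            (use False \<tau> above[OF \<tau>(1) v(3)] eqs in \<open>auto simp: pairing_diff_left\<close>)
        then show ?thesis
          using a[OF \<tau>(1)] by (intro decomposed[of "?a \<tau>" "m - ?a \<tau>"]) auto
      qed
    next
      case False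
      \<comment> \<open>The edge comparison requires a positive second coordinate, and
        \<open>e\<^sub>1\<close> is the only point of \<open>S\<close> without one. There the two
        inequalities for the first coordinate become an equality.\<close>
      then have "v = e\<^sub>1"
        using v(1) by (auto simp: S_def closed_segment_def vec_eq_iff forall_2)
      then have x: "(?a \<tau> + ?b \<tau>) $ 1 = m $ 1"
        using \<tau> v above[OF \<tau>(1), of e\<^sub>1] by (simp add: pairing_2)
      \<comment> \<open>Full dimension supplies a vector of \<tau> off the first axis. As the first
        coordinates agree, evaluation at it compares the second coordinates, and
        \<open>corner\<close> applies to \<tau>.\<close>
      obtain w\<^sub>0 where "w\<^sub>0 \<in> interior \<tau>"
        using interior_max_cone_nonempty[OF proper \<tau>(1)] by auto
      then obtain e where e: "e > 0" "w\<^sub>0 + e *\<^sub>R e\<^sub>2 \<in> \<tau>"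
        by (rule interior_direction)
      define w where "w = w\<^sub>0 + e *\<^sub>R e\<^sub>2"
      have "w\<^sub>0 $ 2 \<ge> 0"
        using in_supp[OF \<tau>(1)] \<open>w\<^sub>0 \<in> interior \<tau>\<close> interior_subset mem_supp by blast
      then have "w $ 2 > 0"
        using e by (simp add: w_def add_nonneg_pos)
      moreover have "of_int ((?a \<tau> + ?b \<tau>) $ 2) * w $ 2 \<le> of_int (m $ 2) * w $ 2"
        using above[OF \<tau>(1) e(2)] unfolding w_def[symmetric]
        by (simp add: pairing_2 algebra_simps flip: x)
      ultimately have "(?a \<tau> + ?b \<tau>) $ 2 \<le> m $ 2"
        by (metis mult_le_cancel_right_pos of_int_le_iff)
      then show ?thesis
        using corner[OF \<tau>(1)] x by auto
    qed
  qed
qed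


section \<open>Sections as combinations of characters\<close>

lemma global_sectionsI:
  assumes "\<And>\<sigma>. \<sigma> \<in> max_cones \<Delta> \<Longrightarrow> s \<sigma> \<in> chart_ring \<sigma>"
    and "\<And>\<sigma> \<sigma>'. \<sigma> \<in> max_cones \<Delta> \<Longrightarrow> \<sigma>' \<in> max_cones \<Delta> \<Longrightarrow>
      s \<sigma> = Poly_Mapping.single (local_character h \<sigma>' - local_character h \<sigma>) 1 * s \<sigma>'"
    and "\<And>\<sigma>. \<sigma> \<notin> max_cones \<Delta> \<Longrightarrow> s \<sigma> = 0"
  shows "s \<in> global_sections \<Delta> h"
  using assms unfolding global_sections_def by blast

lemma global_sectionsD:
  assumes "s \<in> global_sections \<Delta> h"
  shows "\<sigma> \<in> max_cones \<Delta> \<Longrightarrow> s \<sigma> \<in> chart_ring \<sigma>"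
    and "\<sigma> \<in> max_cones \<Delta> \<Longrightarrow> \<sigma>' \<in> max_cones \<Delta> \<Longrightarrow>
      s \<sigma> = Poly_Mapping.single (local_character h \<sigma>' - local_character h \<sigma>) 1 * s \<sigma>'"
    and "\<sigma> \<notin> max_cones \<Delta> \<Longrightarrow> s \<sigma> = 0"
  using assms unfolding global_sections_def by blast+

text \<open>This is the character of \<open>m\<close> expressed in the local generators: the
  generator on the chart of \<sigma> corresponds to the local character, which is therefore divided
  out.\<close>

definition character_section ::
    "(real ^ 'l::finite) set set \<Rightarrow> (real ^ 'l \<Rightarrow> real) \<Rightarrow> int ^ 'l \<Rightarrow> 'l section_family" where
  "character_section \<Delta> h m =
     (\<lambda>\<sigma>. if \<sigma> \<in> max_cones \<Delta> then Poly_Mapping.single (m - local_character h \<sigma>) 1 else 0)"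

lemma character_section_in_global_sections:
  assumes "fan_proper_over_affine_space \<Delta>" "fan_linear \<Delta> h" "m \<in> section_polyhedron \<Delta> h"
  shows "character_section \<Delta> h m \<in> global_sections \<Delta> h"
  using assms
  by (auto simp: global_sections_def character_section_def chart_ring_def pairing_diff_left
      pairing_local_character section_polyhedron_def support_def max_cones_def mult_single)

text \<open>Through this rule a decomposition of a lattice point becomes a factorization of a
  section.\<close>

lemma character_section_mult:
  assumes "fan_proper_over_affine_space \<Delta>" "fan_linear \<Delta> h\<^sub>1" "fan_linear \<Delta> h\<^sub>2"
  shows "character_section \<Delta> h\<^sub>1 m * character_section \<Delta> h\<^sub>2 n =
    character_section \<Delta> (h\<^sub>1 + h\<^sub>2) (m + n)"
  using assms
  by (auto simp: character_section_def fun_eq_iff mult_single local_character_add algebra_simps)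

lemma poly_mapping_eq_sum_single:
  "f = (\<Sum>k\<in>Poly_Mapping.keys f. Poly_Mapping.single k (Poly_Mapping.lookup f k))"
  by (rule poly_mapping_eqI)
    (auto simp: lookup_sum lookup_single when_def in_keys_iff)

text \<open>Undoing the local trivializations gives one Laurent polynomial, the same for all charts.
  Regularity on each chart bounds its exponents below by \<open>h\<close> on that cone, and the
  cones cover the support.\<close>

lemma global_section_eq_sum_characters:
  assumes proper: "fan_proper_over_affine_space \<Delta>" and lin: "fan_linear \<Delta> h"
    and s: "s \<in> global_sections \<Delta> h"
  obtains K c where "finite K" "K \<subseteq> section_polyhedron \<Delta> h"
    "s = (\<Sum>m\<in>K. section_scale (c m) (character_section \<Delta> h m))"
proof -
  let ?l = "local_character h"
  have fin: "finite \<Delta>" and "\<Delta> \<noteq> {}"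
    using proper by (auto simp: fan_proper_over_affine_space_def fan_def)
  then obtain \<sigma>\<^sub>0 where \<sigma>\<^sub>0: "\<sigma>\<^sub>0 \<in> max_cones \<Delta>"
    using max_cone_above by blast
  \<comment> \<open>The section restricted to the torus; the choice of the chart is immaterial by
    the gluing condition.\<close>
  define g where "g = Poly_Mapping.single (?l \<sigma>\<^sub>0) 1 * s \<sigma>\<^sub>0"
  have g: "g = Poly_Mapping.single (?l \<sigma>) 1 * s \<sigma>" if "\<sigma> \<in> max_cones \<Delta>" for \<sigma>
  proof -
    have "s \<sigma>\<^sub>0 = Poly_Mapping.single (?l \<sigma> - ?l \<sigma>\<^sub>0) 1 * s \<sigma>"
      by (rule global_sectionsD(2)[OF s \<sigma>\<^sub>0 that])
    then show ?thesis
      by (simp add: g_def mult_single flip: mult.assoc)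
  qed
  show thesis
  proof
    show "finite (Poly_Mapping.keys g)" by simp
    show "Poly_Mapping.keys g \<subseteq> section_polyhedron \<Delta> h"
      unfolding section_polyhedron_def
    proof (intro subsetI CollectI ballI)
      fix m v assume m: "m \<in> Poly_Mapping.keys g" and "v \<in> support \<Delta>"
      then obtain \<sigma> where \<sigma>: "\<sigma> \<in> max_cones \<Delta>" "v \<in> \<sigma>"
        using support_eq_max_cones[OF fin] by auto
      obtain k where "k \<in> Poly_Mapping.keys (s \<sigma>)" "m = ?l \<sigma> + k"
        using m keys_mult[of "Poly_Mapping.single (?l \<sigma>) 1" "s \<sigma>"]
        unfolding g[OF \<sigma>(1)] by auto
      moreover have "s \<sigma> \<in> chart_ring \<sigma>"
        using s \<sigma>(1) by (rule global_sectionsD)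
      ultimately show "h v \<le> pairing m v"
        using \<sigma> by (auto simp: chart_ring_def pairing_add_left pairing_local_character[OF proper lin])
    qed
    show "s = (\<Sum>m\<in>Poly_Mapping.keys g.
        section_scale (Poly_Mapping.lookup g m) (character_section \<Delta> h m))"
    proof
      fix \<sigma>
      have sum_app: "(\<Sum>m\<in>K. f m) \<sigma> = (\<Sum>m\<in>K. f m \<sigma>)" for K and f :: "int ^ 'a \<Rightarrow> 'a section_family"
        by (induction K rule: infinite_finite_induct) auto
      show "s \<sigma> = (\<Sum>m\<in>Poly_Mapping.keys g.
        section_scale (Poly_Mapping.lookup g m) (character_section \<Delta> h m)) \<sigma>"
      proof (cases "\<sigma> \<in> max_cones \<Delta>")
        case True
        have "s \<sigma> = Poly_Mapping.single (- ?l \<sigma>) 1 * g"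
          by (subst g[OF True]) (simp add: mult_single flip: mult.assoc)
        also have "\<dots> = (\<Sum>m\<in>Poly_Mapping.keys g.
            Poly_Mapping.single (m - ?l \<sigma>) (Poly_Mapping.lookup g m))"
          by (subst poly_mapping_eq_sum_single[of g]) (simp add: sum_distrib_left mult_single)
        finally show ?thesis
          using True by (simp add: sum_app section_scale_def character_section_def mult_single)
      next
        case False
        then show ?thesis
          using s by (simp add: sum_app section_scale_def character_section_def global_sectionsD(3))
      qed
    qed
  qed
qed


section \<open>Surjectivity of the multiplication map\<close>

lemma chart_ring_add: "f \<in> chart_ring \<sigma> \<Longrightarrow> g \<in> chart_ring \<sigma> \<Longrightarrow> f + g \<in> chart_ring \<sigma>"
  using Poly_Mapping.keys_add[of f g] by (auto simp: chart_ring_def)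

lemma chart_ring_mult: "f \<in> chart_ring \<sigma> \<Longrightarrow> g \<in> chart_ring \<sigma> \<Longrightarrow> f * g \<in> chart_ring \<sigma>"
  unfolding chart_ring_def using keys_mult[of f g]
  by (auto dest!: subsetD simp: pairing_add_left)

lemma chart_ring_const: "Poly_Mapping.single 0 c \<in> chart_ring \<sigma>"
  by (auto simp: chart_ring_def pairing_def lattice_point_def inner_vec_def split: if_splits)

lemma global_sections_0: "0 \<in> global_sections \<Delta> h"
  by (simp add: global_sections_def chart_ring_def)

lemma global_sections_add:
  assumes s: "s \<in> global_sections \<Delta> h" and t: "t \<in> global_sections \<Delta> h"
  shows "s + t \<in> global_sections \<Delta> h"
proof (rule global_sectionsI)
  fix \<sigma> \<sigma>' assume "\<sigma> \<in> max_cones \<Delta>" "\<sigma>' \<in> max_cones \<Delta>"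
  then show "(s + t) \<sigma> =
      Poly_Mapping.single (local_character h \<sigma>' - local_character h \<sigma>) 1 * (s + t) \<sigma>'"
    using global_sectionsD(2)[OF s, of \<sigma> \<sigma>'] global_sectionsD(2)[OF t, of \<sigma> \<sigma>']
    unfolding plus_fun_def distrib_left by metis
qed (use global_sectionsD(1,3)[OF s] global_sectionsD(1,3)[OF t] in \<open>auto simp: chart_ring_add\<close>)

lemma global_sections_scale:
  assumes s: "s \<in> global_sections \<Delta> h"
  shows "section_scale c s \<in> global_sections \<Delta> h"
proof (rule global_sectionsI)
  fix \<sigma> \<sigma>' assume "\<sigma> \<in> max_cones \<Delta>" "\<sigma>' \<in> max_cones \<Delta>"
  then show "section_scale c s \<sigma> =
      Poly_Mapping.single (local_character h \<sigma>' - local_character h \<sigma>) 1 * section_scale c s \<sigma>'"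
    using global_sectionsD(2)[OF s, of \<sigma> \<sigma>'] unfolding section_scale_def
    by (metis mult.left_commute)
qed (use global_sectionsD(1,3)[OF s] in
  \<open>auto simp: section_scale_def chart_ring_mult chart_ring_const\<close>)

text \<open>Local characters add, so the transition characters of the two bundles multiply to that
  of the bundle of the sum.\<close>

lemma global_sections_mult:
  assumes "fan_proper_over_affine_space \<Delta>" "fan_linear \<Delta> h\<^sub>1" "fan_linear \<Delta> h\<^sub>2"
    and s: "s \<in> global_sections \<Delta> h\<^sub>1" and t: "t \<in> global_sections \<Delta> h\<^sub>2"
  shows "s * t \<in> global_sections \<Delta> (h\<^sub>1 + h\<^sub>2)"
proof -
  have compat: "(s * t) \<sigma> = Poly_Mapping.single
      (local_character (h\<^sub>1 + h\<^sub>2) \<sigma>' - local_character (h\<^sub>1 + h\<^sub>2) \<sigma>) 1 * (s * t) \<sigma>'"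
    if \<sigma>: "\<sigma> \<in> max_cones \<Delta>" and \<sigma>': "\<sigma>' \<in> max_cones \<Delta>" for \<sigma> \<sigma>'
  proof -
    define x y where "x = local_character h\<^sub>1 \<sigma>' - local_character h\<^sub>1 \<sigma>"
      and "y = local_character h\<^sub>2 \<sigma>' - local_character h\<^sub>2 \<sigma>"
    have "s \<sigma> = Poly_Mapping.single x 1 * s \<sigma>'" "t \<sigma> = Poly_Mapping.single y 1 * t \<sigma>'"
      unfolding x_def y_def
      by (rule global_sectionsD(2)[OF s \<sigma> \<sigma>'] global_sectionsD(2)[OF t \<sigma> \<sigma>'])+
    then have "(s * t) \<sigma> = (Poly_Mapping.single x 1 * Poly_Mapping.single y 1) * (s * t) \<sigma>'"
      by (simp add: ac_simps)
    also have "Poly_Mapping.single x 1 * Poly_Mapping.single y 1 =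
        Poly_Mapping.single (local_character (h\<^sub>1 + h\<^sub>2) \<sigma>' - local_character (h\<^sub>1 + h\<^sub>2) \<sigma>) (1::complex)"
      using assms \<sigma> \<sigma>' by (simp add: mult_single local_character_add x_def y_def algebra_simps)
    finally show ?thesis .
  qed
  show ?thesis
    by (rule global_sectionsI[OF _ compat])
      (use global_sectionsD(1,3)[OF s] global_sectionsD(1,3)[OF t] in \<open>auto simp: chart_ring_mult\<close>)
qed

section \<open>Passage from tensor classes to formal tensors\<close>

lemma formal_multiplication_sum:
  "formal_multiplication (\<Sum>i\<in>I. f i) = (\<Sum>i\<in>I. formal_multiplication (f i))"
proof -
  have "formal_multiplication 0 = 0"
    by (simp add: formal_multiplication_def)
  then show ?thesis
    by (induction I rule: infinite_finite_induct) (simp_all add: formal_multiplication_add)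
qed

text \<open>The classes are exactly those of formal tensors, and each formal tensor lies in its own
  class because the relations contain 0. Surjectivity can thus be checked before passing to the
  quotient.\<close>

lemma multiplication_map_image:
  "multiplication_map ` tensor_product section_scale A B = formal_multiplication ` formal_tensors A B"
proof -
  interpret P: module "\<lambda>c::complex. Poly_Mapping.map ((*) c)"
    by (rule module_poly_mapping_scale)
  let ?R = "{(x, y). x \<in> formal_tensors A B \<and> y \<in> formal_tensors A B \<and>
              x - y \<in> bilinearity_relations section_scale A B}"
  have self: "x \<in> ?R `` {x}" if "x \<in> formal_tensors A B" for x
    using that by (simp add: bilinearity_relations_def P.span_zero)
  have "?R `` {x} \<in> tensor_product section_scale A B" if "x \<in> formal_tensors A B" for x
    unfolding tensor_product_def using that by (rule quotientI)
  then have eq: "multiplication_map (?R `` {x}) = formal_multiplication x"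
    if "x \<in> formal_tensors A B" for x
    using self that multiplication_map_class by blast
  have "tensor_product section_scale A B = (\<lambda>x. ?R `` {x}) ` formal_tensors A B"
    by (auto simp: tensor_product_def quotient_def)
  then show ?thesis
    by (simp only: image_image) (rule image_cong[OF refl eq])
qed

lemma formal_multiplication_in_global_sections:
  assumes "fan_proper_over_affine_space \<Delta>" "fan_linear \<Delta> h\<^sub>1" "fan_linear \<Delta> h\<^sub>2"
    and x: "x \<in> formal_tensors (global_sections \<Delta> h\<^sub>1) (global_sections \<Delta> h\<^sub>2)"
  shows "formal_multiplication x \<in> global_sections \<Delta> (h\<^sub>1 + h\<^sub>2)"
proof -
  let ?G = "global_sections \<Delta> (h\<^sub>1 + h\<^sub>2)"
  have sum: "(\<Sum>p\<in>K. f p) \<in> ?G" if "\<And>p. p \<in> K \<Longrightarrow> f p \<in> ?G"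
    for K and f :: "'a section_family \<times> 'a section_family \<Rightarrow> _"
    using that by (induction K rule: infinite_finite_induct)
      (auto simp: global_sections_0 global_sections_add)
  show ?thesis
    unfolding formal_multiplication_def
    by (rule sum)
      (use x in \<open>auto simp: formal_tensors_def
        intro!: global_sections_scale global_sections_mult[OF assms(1-3)]\<close>)
qed

theorem theorem6p1:
  fixes \<Delta> :: "(real ^ 2) set set"
    and h\<^sub>1 h\<^sub>2 :: "real ^ 2 \<Rightarrow> real"
  assumes "fan_proper_over_affine_space \<Delta>" and "smooth_fan \<Delta>"
    and "fan_linear \<Delta> h\<^sub>1" and "fan_linear \<Delta> h\<^sub>2"
    and "globally_generated \<Delta> h\<^sub>1" and "globally_generated \<Delta> h\<^sub>2"
    and "strictly_convex_on_same_fan \<Delta> h\<^sub>1 h\<^sub>2"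
  shows "multiplication_map `
           tensor_product section_scale (global_sections \<Delta> h\<^sub>1) (global_sections \<Delta> h\<^sub>2)
         = global_sections \<Delta> (h\<^sub>1 + h\<^sub>2)"
  unfolding multiplication_map_image
proof (intro equalityI subsetI)
  let ?T = "formal_tensors (global_sections \<Delta> h\<^sub>1) (global_sections \<Delta> h\<^sub>2)"
  note proper = assms(1) and lin = assms(3,4)
  show "s \<in> global_sections \<Delta> (h\<^sub>1 + h\<^sub>2)" if "s \<in> formal_multiplication ` ?T" for s
    using that formal_multiplication_in_global_sections[OF proper lin] by auto
  \<comment> \<open>The lattice points are decomposed over the common fan, where both functions are
    known to be linear and convex; equal supports carry the result back to \<Delta>.\<close>
  obtain \<Delta>' where \<Delta>': "fan \<Delta>'" "refines \<Delta> \<Delta>'" "strictly_convex \<Delta>' h\<^sub>1" "strictly_convex \<Delta>' h\<^sub>2"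
    using assms(7) by (auto simp: strictly_convex_on_same_fan_def)
  then have supp: "support \<Delta>' = support \<Delta>" and proper': "fan_proper_over_affine_space \<Delta>'"
    using proper by (auto simp: refines_def fan_proper_over_affine_space_def)
  have poly: "section_polyhedron \<Delta>' h = section_polyhedron \<Delta> h" for h
    by (simp add: section_polyhedron_def supp)
  have "\<exists>m\<^sub>1 m\<^sub>2. m\<^sub>1 \<in> section_polyhedron \<Delta> h\<^sub>1 \<and> m\<^sub>2 \<in> section_polyhedron \<Delta> h\<^sub>2 \<and> m = m\<^sub>1 + m\<^sub>2"
    if "m \<in> section_polyhedron \<Delta> (h\<^sub>1 + h\<^sub>2)" for m
    using section_polyhedron_decompose[OF proper', of h\<^sub>1 h\<^sub>2 m] \<Delta>'(3,4) that
    unfolding strictly_convex_def poly by metis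
  then obtain p q where pq: "\<And>m. m \<in> section_polyhedron \<Delta> (h\<^sub>1 + h\<^sub>2) \<Longrightarrow>
      p m \<in> section_polyhedron \<Delta> h\<^sub>1 \<and> q m \<in> section_polyhedron \<Delta> h\<^sub>2 \<and> m = p m + q m"
    by metis
  fix s assume "s \<in> global_sections \<Delta> (h\<^sub>1 + h\<^sub>2)"
  then obtain K c where K: "finite K" "K \<subseteq> section_polyhedron \<Delta> (h\<^sub>1 + h\<^sub>2)"
    and s: "s = (\<Sum>m\<in>K. section_scale (c m) (character_section \<Delta> (h\<^sub>1 + h\<^sub>2) m))"
    by (rule global_section_eq_sum_characters[OF proper fan_linear_add[OF lin]])
  \<comment> \<open>The preimage replaces each character \<open>m\<close> of \<open>s\<close> by the
    pair of characters \<open>p m\<close> and \<open>q m\<close>, with the same coefficient.\<close>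
  define x where "x = (\<Sum>m\<in>K. Poly_Mapping.single
    (character_section \<Delta> h\<^sub>1 (p m), character_section \<Delta> h\<^sub>2 (q m)) (c m))"
  have "Poly_Mapping.keys x \<subseteq>
      (\<Union>m\<in>K. {(character_section \<Delta> h\<^sub>1 (p m), character_section \<Delta> h\<^sub>2 (q m))})"
    unfolding x_def by (rule order_trans[OF keys_sum]) (auto split: if_splits)
  also have "\<dots> \<subseteq> global_sections \<Delta> h\<^sub>1 \<times> global_sections \<Delta> h\<^sub>2"
    using K pq by (auto intro!: character_section_in_global_sections proper lin)
  finally have "x \<in> ?T"
    by (simp add: formal_tensors_def)
  moreover have "formal_multiplication x = s"
    unfolding x_def s formal_multiplication_sum formal_multiplication_single
      character_section_mult[OF proper lin]
    using K pq by (intro sum.cong) auto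
  ultimately show "s \<in> formal_multiplication ` ?T"
    by auto
qed

end
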